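(* Let $p$ be a prime and let $\psi \in C(\mathbb{Z}_p,\mathbb{C}_p)$. The function $\mathbb{Z}\to\mathbb{C}_p$, $m\mapsto\mathscr{S}^m(\psi)(-1)$, has a unique extension to a continuous function $\mathbb{Z}_p\to\mathbb{C}_p$. This continuous extension is in fact $\mathscr{I}(\psi)$ and is therefore locally analytic on $\mathbb{Z}_p$.
   Context: $C(\mathbb{Z}_p,\mathbb{C}_p)$ is the $\mathbb{C}_p$-vector space of continuous functions $\mathbb{Z}_p \to \mathbb{C}_p$, and $\mathscr{S}$ is the $\mathbb{C}_p$-linear automorphism of $C(\mathbb{Z}_p,\mathbb{C}_p)$ given by $\mathscr{S}(\phi)(x) = \phi(x) - x\phi(x-1)$; $\mathscr{S}^m$ for $m\in\mathbb{Z}$ denotes its $m$th iterate (iterates of the inverse for $m<0$). For $\psi \in C(\mathbb{Z}_p,\mathbb{C}_p)$, $\mathscr{I}(\psi):\mathbb{Z}_p\to\mathbb{C}_p$ is the continuous function $\mathscr{I}(\psi)(s) = \sum_{n=0}^\infty n!\,\psi(-1-n)\binom{s}{n}$. A function $f : \mathbb{Z}_p \to \mathbb{C}_p$ is locally analytic if every $x_0 \in \mathbb{Z}_p$ has a neighbourhood in $\mathbb{Z}_p$ on which $f$ is given by a convergent power series in $x - x_0$ with coefficients in $\mathbb{C}_p$. *)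

theory Defs
  imports "HOL-Analysis.Analysis" "HOL-Computational_Algebra.Polynomial"
    "HOL-Computational_Algebra.Primes"
begin

text \<open>
  Fields complete with respect to a non-archimedean absolute value. The library constant
  \<open>norm\<close> is tied to real vector spaces, hence the separate constant \<open>absval\<close>; the metric,
  and thereby the topology, is the one induced by it.
\<close>

class complete_ultrametric_field = field_char_0 + complete_space +
  fixes absval :: "'a \<Rightarrow> real"
  assumes dist_absval: "dist x y = absval (x - y)"
    and absval_mult: "absval (x * y) = absval x * absval y"
    and absval_add_le_max: "absval (x + y) \<le> max (absval x) (absval y)"

text \<open>
  In a complete field whose absolute value satisfies \<open>absval p = 1 / p\<close>, the absolute value restricts
  to the p-adic one on the rationals, so the closures of the rationals and of the integers are
  their completions, i.e. the p-adic numbers and the p-adic integers (see also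
  \<open>Zp_eq_unit_ball\<close>).
\<close>

definition Qp :: "'c::complete_ultrametric_field set"
  where "Qp = closure \<rat>"

definition Zp :: "'c::complete_ultrametric_field set"
  where "Zp = closure \<int>"

definition Qp_algebraic :: "'c::complete_ultrametric_field set"
  where "Qp_algebraic = {x. \<exists>f. f \<noteq> 0 \<and> set (coeffs f) \<subseteq> Qp \<and> poly f x = 0}"

text \<open>
  The field \<open>'c\<close> is the completion of an algebraic closure of the p-adic numbers, with the
  absolute value normalised by \<open>absval p = 1 / p\<close>: the elements algebraic over the p-adic numbers
  form an algebraically closed field, and they are dense. This determines \<open>'c\<close> up to isometric
  isomorphism.
\<close>

definition is_Cp :: "nat \<Rightarrow> 'c::complete_ultrametric_field itself \<Rightarrow> bool"
  where "is_Cp p _ \<longleftrightarrow>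
    absval (of_nat p :: 'c) = 1 / real p \<and>
    (\<forall>f :: 'c poly. degree f > 0 \<longrightarrow> set (coeffs f) \<subseteq> Qp_algebraic \<longrightarrow>
       (\<exists>x \<in> Qp_algebraic. poly f x = 0)) \<and>
    closure (Qp_algebraic :: 'c set) = UNIV"

text \<open>
  Functions on the p-adic integers are represented by functions that are \<^const>\<open>undefined\<close>
  outside of \<^const>\<open>Zp\<close>, so that equality is equality of functions on \<^const>\<open>Zp\<close>.
\<close>

definition CZp :: "('c::complete_ultrametric_field \<Rightarrow> 'c) set"
  where "CZp = {\<phi> \<in> extensional Zp. continuous_on Zp \<phi>}"

definition S_op :: "('c::complete_ultrametric_field \<Rightarrow> 'c) \<Rightarrow> 'c \<Rightarrow> 'c"
  where "S_op \<phi> = restrict (\<lambda>x. \<phi> x - x * \<phi> (x - 1)) Zp"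

text \<open>\<open>inv_into\<close> is the genuine inverse by lemma \<open>bij_betw_S_op\<close>.\<close>

definition S_iter :: "int \<Rightarrow> ('c::complete_ultrametric_field \<Rightarrow> 'c) \<Rightarrow> 'c \<Rightarrow> 'c"
  where "S_iter m = (if m \<ge> 0 then S_op ^^ nat m else inv_into CZp S_op ^^ nat (- m))"

definition I_op :: "('c::complete_ultrametric_field \<Rightarrow> 'c) \<Rightarrow> 'c \<Rightarrow> 'c"
  where "I_op \<psi> = restrict (\<lambda>s. \<Sum>n. fact n * \<psi> (- 1 - of_nat n) * (s gchoose n)) Zp"

definition locally_analytic_on_Zp :: "('c::complete_ultrametric_field \<Rightarrow> 'c) \<Rightarrow> bool"
  where "locally_analytic_on_Zp f \<longleftrightarrow>
    (\<forall>x0 \<in> Zp. \<exists>U a. open U \<and> x0 \<in> U \<and> (\<forall>x \<in> U \<inter> Zp. (\<lambda>n. a n * (x - x0) ^ n) sums f x))"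

lemma absval_zero [simp]: "absval (0::'c::complete_ultrametric_field) = 0"
  using dist_absval[of "0::'c" 0] by simp

lemma absval_eq_dist: "absval (x::'c::complete_ultrametric_field) = dist x 0"
  by (simp add: dist_absval)

lemma absval_ge_zero [simp]: "absval (x::'c::complete_ultrametric_field) \<ge> 0"
  by (simp add: absval_eq_dist)

lemma absval_eq_zero [simp]: "absval (x::'c::complete_ultrametric_field) = 0 \<longleftrightarrow> x = 0"
  by (simp add: absval_eq_dist)

lemma absval_one [simp]: "absval (1::'c::complete_ultrametric_field) = 1"
  using absval_mult[of "1::'c" 1] by simp

lemma absval_minus [simp]: "absval (- x::'c::complete_ultrametric_field) = absval x"
proof -
  have "(absval (-1::'c))\<^sup>2 = 1"
    using absval_mult[of "-1::'c" "-1"] by (simp add: power2_eq_square)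
  hence "absval (-1::'c) = 1"
    using absval_ge_zero[of "-1::'c"] by (auto simp: power2_eq_1_iff)
  thus ?thesis
    using absval_mult[of "-1" x] by simp
qed

lemma absval_diff_le_max: "absval (x - y::'c::complete_ultrametric_field) \<le> max (absval x) (absval y)"
  using absval_add_le_max[of x "-y"] by simp

lemma absval_power: "absval (x ^ n::'c::complete_ultrametric_field) = absval x ^ n"
  by (induction n) (auto simp: absval_mult)

lemma absval_sum_le:
  fixes f :: "'a \<Rightarrow> 'c::complete_ultrametric_field"
  assumes "\<And>i. i \<in> A \<Longrightarrow> absval (f i) \<le> B" "B \<ge> 0"
  shows "absval (sum f A) \<le> B"
  using assms(1)
proof (induction A rule: infinite_finite_induct)
  case (insert a A)
  then show ?case using absval_add_le_max[of "f a" "sum f A"] by force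
qed (use assms(2) in auto)

lemma absval_of_nat_le_one: "absval (of_nat n::'c::complete_ultrametric_field) \<le> 1"
proof (induction n)
  case (Suc n)
  then show ?case using absval_add_le_max[of 1 "of_nat n::'c"] by simp
qed simp

lemma absval_of_int_le_one: "absval (of_int n::'c::complete_ultrametric_field) \<le> 1"
  by (cases n rule: int_cases2) (auto simp: absval_of_nat_le_one)

lemma cuf_tendsto_iff:
  fixes f :: "'a \<Rightarrow> 'c::complete_ultrametric_field"
  shows "(f \<longlongrightarrow> l) F \<longleftrightarrow> ((\<lambda>x. absval (f x - l)) \<longlongrightarrow> 0) F"
  by (subst tendsto_dist_iff) (simp add: dist_absval)

instance complete_ultrametric_field \<subseteq> topological_ab_group_add
proof
  fix a b :: 'a
  show "((\<lambda>x. fst x + snd x) \<longlongrightarrow> a + b) (nhds a \<times>\<^sub>F nhds b)"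
  proof (subst cuf_tendsto_iff, rule tendsto_sandwich[where f = "\<lambda>_. 0"])
    have "((\<lambda>x. max (absval (fst x - a)) (absval (snd x - b))) \<longlongrightarrow> max 0 0) (nhds a \<times>\<^sub>F nhds b)"
      by (intro tendsto_max; subst cuf_tendsto_iff[symmetric])
         (auto intro: filterlim_fst filterlim_snd)
    thus "((\<lambda>x. max (absval (fst x - a)) (absval (snd x - b))) \<longlongrightarrow> 0) (nhds a \<times>\<^sub>F nhds b)"
      by simp
    have "absval (fst x + snd x - (a + b)) \<le> max (absval (fst x - a)) (absval (snd x - b))" for x
      using absval_add_le_max[of "fst x - a" "snd x - b"] by (simp add: algebra_simps)
    thus "\<forall>\<^sub>F x in nhds a \<times>\<^sub>F nhds b. absval (fst x + snd x - (a + b))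
            \<le> max (absval (fst x - a)) (absval (snd x - b))"
      by simp
  qed auto
  show "(uminus \<longlongrightarrow> - a) (nhds a)"
  proof (subst cuf_tendsto_iff)
    have "absval (- x - - a) = absval (x - a)" for x :: 'a
      using absval_minus[of "x - a"] by (simp add: algebra_simps)
    thus "((\<lambda>x. absval (- x - - a)) \<longlongrightarrow> 0) (nhds a)"
      using cuf_tendsto_iff[of "\<lambda>x. x" a "nhds a"] by (simp add: filterlim_ident)
  qed
qed

instance complete_ultrametric_field \<subseteq> topological_comm_monoid_mult
proof
  fix a b :: 'a
  let ?F = "nhds a \<times>\<^sub>F nhds b"
  show "((\<lambda>x. fst x * snd x) \<longlongrightarrow> a * b) ?F"
  proof (subst cuf_tendsto_iff, rule tendsto_sandwich[where f = "\<lambda>_. 0"])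
    have 1: "((\<lambda>x. absval (fst x - a)) \<longlongrightarrow> 0) ?F" "((\<lambda>x. absval (snd x - b)) \<longlongrightarrow> 0) ?F"
      by (subst cuf_tendsto_iff[symmetric]; auto intro: filterlim_fst filterlim_snd)+
    have "((\<lambda>x. absval (fst x - a) * absval (snd x - b) + absval (fst x - a) * absval b
           + absval a * absval (snd x - b)) \<longlongrightarrow> 0 * 0 + 0 * absval b + absval a * 0) ?F"
      by (intro tendsto_intros 1)
    thus "((\<lambda>x. absval (fst x - a) * absval (snd x - b) + absval (fst x - a) * absval b
           + absval a * absval (snd x - b)) \<longlongrightarrow> 0) ?F" by simp
    have le: "absval (u + v) \<le> absval u + absval v" for u v :: 'a
      using absval_add_le_max[of u v] absval_ge_zero[of u] absval_ge_zero[of v] by linarith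
    have "absval (fst x * snd x - a * b) \<le> absval (fst x - a) * absval (snd x - b)
           + absval (fst x - a) * absval b + absval a * absval (snd x - b)" for x
    proof -
      have "fst x * snd x - a * b = (fst x - a) * (snd x - b) + (fst x - a) * b + a * (snd x - b)"
        by (simp add: algebra_simps)
      also have "absval \<dots> \<le> absval ((fst x - a) * (snd x - b) + (fst x - a) * b) + absval (a * (snd x - b))"
        by (rule le)
      also have "\<dots> \<le> absval ((fst x - a) * (snd x - b)) + absval ((fst x - a) * b) + absval (a * (snd x - b))"
        by (intro add_right_mono le)
      finally show ?thesis by (simp add: absval_mult)
    qed
    thus "\<forall>\<^sub>F x in ?F. absval (fst x * snd x - a * b) \<le> absval (fst x - a) * absval (snd x - b)
           + absval (fst x - a) * absval b + absval a * absval (snd x - b)"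
      by simp
  qed auto
qed

lemma continuous_on_absval:
  "continuous_on A (absval :: 'c::complete_ultrametric_field \<Rightarrow> real)"
  unfolding absval_eq_dist by (intro continuous_intros)

lemma cuf_Cauchy_partial_sums:
  fixes f :: "nat \<Rightarrow> 'c::complete_ultrametric_field"
  assumes "\<And>n. n \<ge> N \<Longrightarrow> absval (f n) \<le> B" "B \<ge> 0" "m \<ge> N" "n \<ge> N"
  shows "dist (sum f {..<m}) (sum f {..<n}) \<le> B"
proof -
  have *: "dist (sum f {..<m}) (sum f {..<n}) \<le> B" if "N \<le> m" "m \<le> n" for m n
  proof -
    have "sum f {..<n} - sum f {..<m} = sum f {m..<n}"
      using that by (simp add: sum_diff_nat_ivl lessThan_atLeast0)
    moreover have "absval (sum f {m..<n}) \<le> B"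
      by (rule absval_sum_le) (use assms that in auto)
    ultimately show ?thesis
      by (metis dist_commute dist_absval)
  qed
  show ?thesis
    using *[of m n] *[of n m] assms(3,4) by (metis dist_commute nle_le)
qed

lemma cuf_summable:
  fixes f :: "nat \<Rightarrow> 'c::complete_ultrametric_field"
  assumes "(\<lambda>n. absval (f n)) \<longlonglongrightarrow> 0"
  shows "summable f"
proof -
  have "Cauchy (\<lambda>n. sum f {..<n})"
  proof (rule metric_CauchyI)
    fix e :: real assume e: "e > 0"
    then obtain N where N: "\<And>n. n \<ge> N \<Longrightarrow> absval (f n) \<le> e / 2"
      using LIMSEQ_D[OF assms, of "e / 2"] by force
    show "\<exists>M. \<forall>m\<ge>M. \<forall>n\<ge>M. dist (sum f {..<m}) (sum f {..<n}) < e"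
    proof (intro exI allI impI)
      fix m n assume "m \<ge> N" "n \<ge> N"
      thus "dist (sum f {..<m}) (sum f {..<n}) < e"
        using cuf_Cauchy_partial_sums[of N f "e / 2" m n] N e by force
    qed
  qed
  thus ?thesis
    by (simp add: Cauchy_convergent summable_iff_convergent)
qed

lemma of_int_in_Zp [simp]: "of_int n \<in> Zp"
  unfolding Zp_def using closure_subset[of "\<int> :: 'a set"] by auto

lemma of_nat_in_Zp [simp]: "of_nat n \<in> Zp"
  using of_int_in_Zp[of "int n"] by simp

lemma Zp_closure_induct:
  assumes "x \<in> Zp" "closed {x. P x}" "\<And>n. P (of_int n)"
  shows "P x"
proof -
  have "Zp \<subseteq> {x. P x}"
    unfolding Zp_def using assms(2,3) by (intro closure_minimal) (auto elim: Ints_cases)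
  thus ?thesis using assms(1) by auto
qed

lemma diff_of_nat_in_Zp [simp]:
  assumes "x \<in> Zp" shows "x - of_nat n \<in> Zp"
proof (rule Zp_closure_induct[OF assms])
  have "closed ((\<lambda>x::'a. x - of_nat n) -` Zp)"
    by (intro closed_vimage continuous_intros) (simp add: Zp_def)
  thus "closed {x::'a. x - of_nat n \<in> Zp}" by (simp add: vimage_def)
  show "of_int k - of_nat n \<in> (Zp::'a set)" for k
    using of_int_in_Zp[of "k - int n"] by simp
qed

lemma diff_one_in_Zp [simp]: "x \<in> Zp \<Longrightarrow> x - 1 \<in> Zp"
  using diff_of_nat_in_Zp[of x 1] by simp

lemma absval_gchoose_le_one:
  fixes x :: "'c::complete_ultrametric_field"
  assumes "x \<in> Zp"
  shows "absval (x gchoose n) \<le> 1"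
proof -
  have "continuous_on UNIV (\<lambda>x::'c. inverse (fact n) * (\<Prod>i = 0..<n. x - of_nat i))"
    by (intro continuous_on_mult' continuous_on_prod' continuous_intros)
  hence cont: "continuous_on UNIV (\<lambda>x::'c. x gchoose n)"
    by (simp add: gbinomial_prod_rev field_simps)
  show ?thesis
  proof (rule Zp_closure_induct[OF assms])
    show "closed {x::'c. absval (x gchoose n) \<le> 1}"
      by (intro closed_Collect_le continuous_on_compose2[OF continuous_on_absval cont]
            continuous_intros) auto
    show "absval ((of_int k :: 'c) gchoose n) \<le> 1" for k
      by (simp flip: of_int_gbinomial add: absval_of_int_le_one)
  qed
qed

lemma is_Cp_absval_p:
  assumes "is_Cp p TYPE('c::complete_ultrametric_field)"
  shows "absval (of_nat p :: 'c) = 1 / real p"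
  using assms by (simp add: is_Cp_def)

lemma absval_p_power_tendsto_zero:
  assumes "prime p" "is_Cp p TYPE('c::complete_ultrametric_field)"
  shows "(\<lambda>n. absval (of_nat p ^ n :: 'c)) \<longlonglongrightarrow> 0"
proof -
  have "real p > 1" using prime_gt_1_nat[OF assms(1)] by simp
  thus ?thesis
    by (auto simp: absval_power is_Cp_absval_p[OF assms(2)] intro!: LIMSEQ_power_zero)
qed

lemma Zp_eq_unit_ball:
  assumes "prime p" "is_Cp p TYPE('c::complete_ultrametric_field)"
  shows "(Zp :: 'c set) = {x \<in> Qp. absval x \<le> 1}"
proof (intro equalityI subsetI)
  fix x :: 'c assume x: "x \<in> Zp"
  have "x \<in> Qp"
    using x closure_mono[of "\<int> :: 'c set" \<rat>] Ints_subset_Rats unfolding Zp_def Qp_def by blast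
  moreover have "absval x \<le> 1"
    using absval_gchoose_le_one[OF x, of 1] by simp
  ultimately show "x \<in> {x \<in> Qp. absval x \<le> 1}" by simp
next
  fix x :: 'c assume "x \<in> {x \<in> Qp. absval x \<le> 1}"
  hence x: "x \<in> Qp" "absval x \<le> 1" by auto
  have p_lt: "absval (of_nat p :: 'c) < 1"
    using prime_gt_1_nat[OF assms(1)] by (simp add: is_Cp_absval_p[OF assms(2)])
  have dvd: "absval (of_int k :: 'c) < 1" if k_dvd: "int p dvd k" for k
  proof -
    obtain j where "k = int p * j" using k_dvd unfolding dvd_def by blast
    hence "absval (of_int k :: 'c) = absval (of_nat p :: 'c) * absval (of_int j :: 'c)"
      by (simp add: absval_mult)
    also have "\<dots> \<le> absval (of_nat p :: 'c) * 1"
      by (intro mult_left_mono absval_of_int_le_one) auto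
    finally show ?thesis using p_lt by simp
  qed
  have coprime_absval: "absval (of_int k :: 'c) = 1" if k_coprime: "coprime k (int p)" for k
  proof (rule ccontr)
    assume "absval (of_int k :: 'c) \<noteq> 1"
    hence less: "absval (of_int k :: 'c) < 1"
      using absval_of_int_le_one[of k, where ?'c = 'c] by linarith
    obtain u v where uv: "u * k + v * int p = 1"
      using k_coprime bezout_int[of k "int p"] by (metis coprime_imp_gcd_eq_1)
    have "absval (of_int (u * k) :: 'c) < 1"
    proof -
      have "absval (of_int u :: 'c) * absval (of_int k :: 'c) \<le> 1 * absval (of_int k :: 'c)"
        by (intro mult_right_mono absval_of_int_le_one) auto
      thus ?thesis using less by (simp add: absval_mult)
    qed
    moreover have "absval (of_int (v * int p) :: 'c) < 1"
      by (rule dvd) simp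
    ultimately have "absval (of_int (u * k) + of_int (v * int p) :: 'c) < 1"
      using absval_add_le_max[of "of_int (u * k) :: 'c" "of_int (v * int p)"] by linarith
    thus False by (simp only: of_int_add[symmetric] uv) simp
  qed
  show "x \<in> Zp"
    unfolding Zp_def closure_approachable
  proof (intro allI impI)
    fix e :: real assume e: "e > 0"
    obtain q where q: "q \<in> \<rat>" "dist q x < min e 1"
      using x(1) e unfolding Qp_def closure_approachable by (metis min_less_iff_conj zero_less_one)
    have "absval q \<le> 1"
      using q(2) x(2) absval_add_le_max[of "q - x" x] by (simp add: dist_absval max_def split: if_splits)
    obtain r where r: "q = of_rat r" using q(1) by (elim Rats_cases)
    obtain a b where ab: "r = Rat.Fract a b" "b > 0" "coprime a b" by (cases r)
    have q_eq: "q = of_int a / of_int b"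
      using ab by (simp add: r of_rat_rat)
    have a_le_b: "absval (of_int a :: 'c) \<le> absval (of_int b :: 'c)"
    proof -
      have "absval (of_int a :: 'c) = absval q * absval (of_int b :: 'c)"
        using ab(2) by (simp add: q_eq flip: absval_mult)
      also have "\<dots> \<le> 1 * absval (of_int b :: 'c)"
        by (intro mult_right_mono \<open>absval q \<le> 1\<close>) auto
      finally show ?thesis by simp
    qed
    have "\<not> int p dvd b"
    proof
      assume b: "int p dvd b"
      hence "\<not> int p dvd a"
        using ab(3) assms(1) by (metis coprime_common_divisor not_prime_unit prime_int_nat_transfer
          prime_nat_int_transfer)
      hence "coprime a (int p)"
        using assms(1) by (metis coprime_commute prime_imp_coprime prime_nat_int_transfer)
      thus False using coprime_absval a_le_b dvd[OF b] by fastforce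
    qed
    hence cop: "coprime b (int p)"
      using assms(1) by (metis coprime_commute prime_imp_coprime prime_nat_int_transfer)
    obtain k where k: "absval (of_nat p ^ k :: 'c) < e"
      using LIMSEQ_D[OF absval_p_power_tendsto_zero[OF assms] e] by force
    obtain u v where uv: "u * b + v * int p ^ k = 1"
      using cop bezout_int[of b "int p ^ k"] by (metis coprime_imp_gcd_eq_1 coprime_power_right_iff)
    have "of_int (u * b + v * int p ^ k) = (1::'c)" by (simp only: uv of_int_1)
    hence eq: "1 - of_int u * of_int b = (of_int v * of_nat p ^ k :: 'c)"
      by (simp add: algebra_simps)
    have "of_int a = q * of_int b" using ab(2) by (simp add: q_eq)
    hence "q - of_int (a * u) = q * (1 - of_int u * of_int b)"
      by (simp add: algebra_simps)
    hence "q - of_int (a * u) = q * of_int v * of_nat p ^ k"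
      by (simp add: eq mult.assoc)
    hence "absval (q - of_int (a * u)) = (absval q * absval (of_int v :: 'c)) * absval (of_nat p ^ k :: 'c)"
      by (simp add: absval_mult)
    also have "\<dots> \<le> (1 * 1) * absval (of_nat p ^ k :: 'c)"
      by (intro mult_right_mono mult_mono absval_of_int_le_one \<open>absval q \<le> 1\<close>) auto
    finally have 1: "absval (q - of_int (a * u)) < e" using k by simp
    have "absval (of_int (a * u) - q) < e"
      using 1 absval_minus[of "q - of_int (a * u)"] by simp
    hence "absval (of_int (a * u) - x) < e"
      using absval_add_le_max[of "of_int (a * u) - q" "q - x"] q(2)
      by (simp add: dist_absval max_def split: if_splits)
    thus "\<exists>y\<in>\<int>. dist y x < e"
      by (metis Ints_of_int dist_absval)
  qed
qed

lemma compact_Zp: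
  assumes "prime p" "is_Cp p TYPE('c::complete_ultrametric_field)"
  shows "compact (Zp :: 'c set)"
  unfolding compact_eq_totally_bounded
proof (intro conjI allI impI)
  show "complete (Zp :: 'c set)"
    by (simp add: Zp_def complete_eq_closed)
  fix e :: real assume "e > 0"
  then obtain k where k: "absval (of_nat p ^ k :: 'c) < e"
    using LIMSEQ_D[OF absval_p_power_tendsto_zero[OF assms], of e] by force
  have "x \<in> (\<Union>i<p ^ k. ball (of_nat i) e)" if x: "x \<in> Zp" for x :: 'c
  proof -
    obtain y where y: "y \<in> \<int>" "dist y x < e"
      using x \<open>e > 0\<close> unfolding Zp_def closure_approachable by blast
    obtain m where m: "y = of_int m" using y(1) by (elim Ints_cases)
    define i where "i = nat (m mod int (p ^ k))"
    have "p ^ k > 0" using prime_gt_0_nat[OF assms(1)] by simp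
    hence pos: "int (p ^ k) > 0" by linarith
    have i_eq: "int i = m mod int (p ^ k)"
      using pos by (simp add: i_def del: of_nat_power)
    have i: "i < p ^ k"
      using pos_mod_bound[OF pos, of m] i_eq by linarith
    have "m - int i = int (p ^ k) * (m div int (p ^ k))"
      unfolding i_eq by (simp add: minus_mod_eq_mult_div)
    hence "of_int (m - int i) = (of_int (int (p ^ k) * (m div int (p ^ k))) :: 'c)" by simp
    hence "y - of_nat i = of_nat p ^ k * of_int (m div int (p ^ k))"
      by (simp add: m)
    hence "absval (y - of_nat i) = absval (of_nat p ^ k :: 'c) * absval (of_int (m div int (p ^ k)) :: 'c)"
      by (simp add: absval_mult)
    also have "\<dots> \<le> absval (of_nat p ^ k :: 'c) * 1"
      by (intro mult_left_mono absval_of_int_le_one) auto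
    finally have "absval (y - of_nat i) < e" using k by simp
    moreover have "absval (x - y) < e" using y(2) by (metis dist_commute dist_absval)
    ultimately have "absval (x - of_nat i) < e"
      using absval_add_le_max[of "x - y" "y - of_nat i"] by simp
    hence "x \<in> ball (of_nat i) e"
      by (simp add: dist_commute dist_absval[of x])
    thus ?thesis using i by blast
  qed
  hence "Zp \<subseteq> (\<Union>x\<in>(of_nat ` {..<p ^ k} :: 'c set). ball x e)" by auto
  thus "\<exists>K. finite K \<and> Zp \<subseteq> (\<Union>x\<in>K. ball (x::'c) e)" by blast
qed

lemma absval_fact_tendsto_zero:
  assumes "prime p" "is_Cp p TYPE('c::complete_ultrametric_field)"
  shows "(\<lambda>n. absval (fact n :: 'c)) \<longlonglongrightarrow> 0"
proof (rule LIMSEQ_I)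
  fix e :: real assume "e > 0"
  then obtain k where k: "absval (of_nat p ^ k :: 'c) < e"
    using LIMSEQ_D[OF absval_p_power_tendsto_zero[OF assms], of e] by force
  have pk: "p ^ k dvd fact (p * k)" for k
  proof (induction k)
    case (Suc k)
    define m where "m = p * Suc k - 1"
    have "p > 0" using prime_gt_0_nat[OF assms(1)] .
    hence eq: "p * Suc k = Suc m" and le: "p * k \<le> m" by (simp_all add: m_def)
    have "fact (p * k) dvd (fact m :: nat)" using le by (rule fact_dvd)
    with Suc have "p ^ k dvd fact m" by (rule dvd_trans)
    hence "p * p ^ k dvd (p * Suc k) * fact m"
      by (rule mult_dvd_mono[OF dvd_triv_left])
    also have "(p * Suc k) * fact m = fact (p * Suc k)"
      by (simp only: eq fact_Suc of_nat_id)
    finally show ?case by (simp only: power_Suc)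
  qed simp
  show "\<exists>N. \<forall>n\<ge>N. norm (absval (fact n :: 'c) - 0) < e"
  proof (intro exI allI impI)
    fix n assume "n \<ge> p * k"
    hence "p ^ k dvd (fact n :: nat)"
      using pk[of k] fact_dvd[of "p * k" n, where ?'a = nat] dvd_trans by blast
    then obtain j where "(fact n :: nat) = p ^ k * j" unfolding dvd_def by blast
    hence "(of_nat (fact n) :: 'c) = of_nat (p ^ k * j)" by (simp only:)
    hence "absval (fact n :: 'c) = absval (of_nat p ^ k :: 'c) * absval (of_nat j :: 'c)"
      by (simp add: absval_mult)
    also have "\<dots> \<le> absval (of_nat p ^ k :: 'c) * 1"
      by (intro mult_left_mono absval_of_nat_le_one) auto
    finally show "norm (absval (fact n :: 'c) - 0) < e" using k by simp
  qed
qed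

lemma CZp_bounded:
  assumes "prime p" "is_Cp p TYPE('c::complete_ultrametric_field)" "\<psi> \<in> (CZp :: ('c \<Rightarrow> 'c) set)"
  obtains B where "B > 0" "\<And>x. x \<in> Zp \<Longrightarrow> absval (\<psi> x) \<le> B"
proof -
  have "bounded (\<psi> ` Zp)"
    using assms(3) by (intro compact_imp_bounded compact_continuous_image compact_Zp[OF assms(1,2)])
      (simp add: CZp_def)
  then obtain B where "\<forall>y\<in>\<psi> ` Zp. dist 0 y \<le> B"
    using bounded_any_center by blast
  hence "absval (\<psi> x) \<le> max B 1" if "x \<in> Zp" for x
    using that by (force simp: absval_eq_dist dist_commute)
  thus ?thesis using that[of "max B 1"] by auto
qed

lemma absval_I_op_term_le:
  fixes \<psi> :: "'c::complete_ultrametric_field \<Rightarrow> 'c"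
  assumes "\<And>x. x \<in> Zp \<Longrightarrow> absval (\<psi> x) \<le> B" "y \<in> Zp" "x \<in> Zp"
  shows "absval (fact n * \<psi> y * (x gchoose n)) \<le> absval (fact n :: 'c) * B"
proof -
  have "absval (fact n * \<psi> y * (x gchoose n)) = absval (fact n :: 'c) * absval (\<psi> y) * absval (x gchoose n)"
    by (simp add: absval_mult)
  also have "\<dots> \<le> absval (fact n :: 'c) * B * 1"
    using assms(1)[OF assms(2)] absval_gchoose_le_one[OF assms(3)]
    by (intro mult_mono mult_nonneg_nonneg order_trans[OF absval_ge_zero]) auto
  finally show ?thesis by simp
qed

lemma summable_I_op:
  assumes "prime p" "is_Cp p TYPE('c::complete_ultrametric_field)" "\<psi> \<in> (CZp :: ('c \<Rightarrow> 'c) set)"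
    and "s \<in> Zp"
  shows "summable (\<lambda>n. fact n * \<psi> (- 1 - of_nat n) * (s gchoose n))"
proof -
  obtain B where B: "\<And>x. x \<in> Zp \<Longrightarrow> absval (\<psi> x) \<le> B"
    using CZp_bounded[OF assms(1-3)] by metis
  have *: "- 1 - of_nat n \<in> (Zp :: 'c set)" for n
    using of_int_in_Zp[of "- 1 - int n"] by simp
  show ?thesis
  proof (rule cuf_summable, rule tendsto_sandwich[where f = "\<lambda>_. 0"])
    show "\<forall>\<^sub>F n in sequentially. absval (fact n * \<psi> (- 1 - of_nat n) * (s gchoose n))
            \<le> absval (fact n :: 'c) * B"
      using absval_I_op_term_le[of \<psi> B, OF B * assms(4)] by simp
    show "(\<lambda>n. absval (fact n :: 'c) * B) \<longlonglongrightarrow> 0"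
      using tendsto_mult_right[OF absval_fact_tendsto_zero[OF assms(1,2)], of B] by simp
  qed auto
qed

lemma S_op_in_CZp:
  assumes "\<phi> \<in> CZp"
  shows "S_op \<phi> \<in> CZp"
proof -
  have cont: "continuous_on Zp \<phi>" using assms by (simp add: CZp_def)
  have "continuous_on Zp (\<lambda>x. \<phi> x - x * \<phi> (x - 1))"
    by (intro continuous_on_mult' continuous_intros continuous_on_compose2[OF cont] cont) auto
  thus ?thesis
    by (simp add: CZp_def S_op_def cong: continuous_on_cong)
qed

lemma S_op_eq: "x \<in> Zp \<Longrightarrow> S_op \<phi> x = \<phi> x - x * \<phi> (x - 1)"
  by (simp add: S_op_def)

lemma Zp_subset_closure_Nats:
  assumes "prime p" "is_Cp p TYPE('c::complete_ultrametric_field)"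
  shows "(Zp :: 'c set) \<subseteq> closure \<nat>"
proof
  fix x :: 'c assume "x \<in> Zp"
  thus "x \<in> closure \<nat>"
  proof (rule Zp_closure_induct)
    show "closed {x::'c. x \<in> closure \<nat>}" by simp
    show "of_int m \<in> (closure \<nat> :: 'c set)" for m
      unfolding closure_approachable
    proof (intro allI impI)
      fix e :: real assume "e > 0"
      then obtain k where k: "absval (of_nat p ^ k :: 'c) < e"
        using LIMSEQ_D[OF absval_p_power_tendsto_zero[OF assms], of e] by force
      define j where "j = nat \<bar>m\<bar>"
      have "p ^ k \<ge> 1" using prime_gt_0_nat[OF assms(1)] by simp
      hence "int (p ^ k) \<ge> 1" by linarith
      hence "\<bar>m\<bar> * 1 \<le> \<bar>m\<bar> * int (p ^ k)" by (intro mult_left_mono) auto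
      hence "m + int (j * p ^ k) \<ge> 0" by (simp add: j_def)
      then obtain N where N: "m + int (j * p ^ k) = int N"
        using nonneg_int_cases by blast
      have "of_int (m + int (j * p ^ k)) = (of_int (int N) :: 'c)" by (simp only: N)
      hence "of_nat N - of_int m = of_nat j * (of_nat p ^ k :: 'c)"
        by (simp add: algebra_simps)
      hence "absval (of_nat N - of_int m :: 'c) = absval (of_nat j :: 'c) * absval (of_nat p ^ k :: 'c)"
        by (simp add: absval_mult)
      also have "\<dots> \<le> 1 * absval (of_nat p ^ k :: 'c)"
        by (intro mult_right_mono absval_of_nat_le_one) auto
      finally show "\<exists>y\<in>\<nat>. dist y (of_int m :: 'c) < e"
        using k by (intro bexI[of _ "of_nat N"]) (auto simp: dist_absval)
    qed
  qed
qed

lemma CZp_eqI: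
  assumes "prime p" "is_Cp p TYPE('c::complete_ultrametric_field)"
    and "f \<in> CZp" "g \<in> (CZp :: ('c \<Rightarrow> 'c) set)" "\<And>n. f (of_nat n) = g (of_nat n)"
  shows "f = g"
proof (rule extensionalityI)
  show "f \<in> extensional Zp" "g \<in> extensional Zp" using assms by (auto simp: CZp_def)
  fix x :: 'c assume x: "x \<in> Zp"
  hence "x \<in> closure \<nat>" using Zp_subset_closure_Nats[OF assms(1,2)] by blast
  then obtain X where X: "\<And>n. X n \<in> \<nat>" "X \<longlonglongrightarrow> x"
    unfolding closure_sequential by blast
  have XZ: "X n \<in> Zp" for n using X(1)[of n] by (auto elim: Nats_cases)
  have "continuous_on Zp f" "continuous_on Zp g" using assms by (auto simp: CZp_def)
  hence "(\<lambda>n. f (X n)) \<longlonglongrightarrow> f x" "(\<lambda>n. g (X n)) \<longlonglongrightarrow> g x"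
    using X(2) XZ x unfolding continuous_on_sequentially comp_def by blast+
  moreover have "(\<lambda>n. f (X n)) = (\<lambda>n. g (X n))"
  proof
    show "f (X n) = g (X n)" for n
      using X(1)[of n] assms(5) by (auto elim: Nats_cases)
  qed
  ultimately show "f x = g x"
    using LIMSEQ_unique by metis
qed

lemma bij_betw_S_op:
  assumes "prime p" "is_Cp p TYPE('c::complete_ultrametric_field)"
  shows "bij_betw S_op (CZp :: ('c \<Rightarrow> 'c) set) CZp"
proof (rule bij_betw_imageI)
  show "inj_on S_op (CZp :: ('c \<Rightarrow> 'c) set)"
  proof (rule inj_onI)
    fix f g :: "'c \<Rightarrow> 'c" assume fg: "f \<in> CZp" "g \<in> CZp" "S_op f = S_op g"
    have *: "f x - x * f (x - 1) = g x - x * g (x - 1)" if "x \<in> Zp" for x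
      using fg(3) S_op_eq[OF that] by metis
    have "f (of_nat n) = g (of_nat n)" for n
    proof (induction n)
      case 0
      show ?case using *[OF of_nat_in_Zp[of 0]] by simp
    next
      case (Suc n)
      show ?case using *[OF of_nat_in_Zp[of "Suc n"]] Suc by simp
    qed
    thus "f = g" by (rule CZp_eqI[OF assms fg(1,2)])
  qed
  show "S_op ` CZp = (CZp :: ('c \<Rightarrow> 'c) set)"
  proof (intro equalityI subsetI)
    fix \<psi> :: "'c \<Rightarrow> 'c" assume \<psi>: "\<psi> \<in> CZp"
    hence cont: "continuous_on Zp \<psi>" by (simp add: CZp_def)
    obtain B where B: "B > 0" "\<And>x. x \<in> Zp \<Longrightarrow> absval (\<psi> x) \<le> B"
      using CZp_bounded[OF assms \<psi>] by metis
    define a where "a = (\<lambda>n x. (\<Prod>i<n. x - of_nat i) * \<psi> (x - of_nat n))"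
    define T where "T = (\<lambda>N x. \<Sum>n<N. a n x)"
    have a_le: "absval (a n x) \<le> absval (fact n :: 'c) * B" if "x \<in> Zp" for n x
    proof -
      have "a n x = fact n * \<psi> (x - of_nat n) * (x gchoose n)"
        using gbinomial_mult_fact[of n x] by (simp add: a_def lessThan_atLeast0 mult_ac)
      thus ?thesis
        using absval_I_op_term_le[of \<psi> B "x - of_nat n" x n] B(2) that by simp
    qed
    have "continuous_on Zp (a n)" for n
      unfolding a_def
      by (intro continuous_on_mult' continuous_on_prod' continuous_intros
          continuous_on_compose2[OF cont]) auto
    hence cont_T: "continuous_on Zp (T N)" for N
      unfolding T_def by (intro continuous_on_sum)
    have "uniformly_convergent_on Zp T"
      unfolding uniformly_convergent_eq_Cauchy uniformly_Cauchy_on_def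
    proof (intro allI impI)
      fix e :: real assume "e > 0"
      hence "e / (2 * B) > 0" using B(1) by simp
      then obtain M where M: "\<And>n. n \<ge> M \<Longrightarrow> absval (fact n :: 'c) < e / (2 * B)"
        using LIMSEQ_D[OF absval_fact_tendsto_zero[OF assms]] by force
      show "\<exists>M. \<forall>x\<in>Zp. \<forall>m\<ge>M. \<forall>n\<ge>M. dist (T m x) (T n x) < e"
      proof (intro exI ballI allI impI)
        fix x :: 'c and m n assume x: "x \<in> Zp" and mn: "m \<ge> M" "n \<ge> M"
        have "dist (T m x) (T n x) \<le> e / 2"
          unfolding T_def
        proof (rule cuf_Cauchy_partial_sums[OF _ _ mn])
          fix n assume "n \<ge> M"
          hence "absval (fact n :: 'c) * B \<le> e / 2"
            using M[of n] B(1) by (simp add: field_simps)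
          thus "absval (a n x) \<le> e / 2" using a_le[OF x, of n] by linarith
        qed (use \<open>e > 0\<close> in auto)
        thus "dist (T m x) (T n x) < e" using \<open>e > 0\<close> by linarith
      qed
    qed
    then obtain l where l: "uniform_limit Zp T l sequentially"
      unfolding uniformly_convergent_on_def by blast
    have lim: "(\<lambda>N. T N x) \<longlonglongrightarrow> l x" if "x \<in> Zp" for x
      using l that by (rule tendsto_uniform_limitI)
    have cont_l: "continuous_on Zp l"
      by (rule uniform_limit_theorem[OF _ l]) (auto simp: cont_T)
    define \<phi> where "\<phi> = restrict l Zp"
    have \<phi>: "\<phi> \<in> CZp"
      using cont_l by (simp add: \<phi>_def CZp_def cong: continuous_on_cong)
    have eq: "l x - x * l (x - 1) = \<psi> x" if x: "x \<in> Zp" for x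
    proof -
      have a_Suc: "x * a n (x - 1) = a (Suc n) x" for n
        unfolding a_def prod.lessThan_Suc_shift o_def
        by (simp only: of_nat_Suc of_nat_0 diff_zero diff_diff_eq mult.assoc)
      have "T (Suc N) x - x * T N (x - 1) = \<psi> x" for N
        unfolding T_def sum.lessThan_Suc_shift o_def sum_distrib_left a_Suc
        by (simp add: a_def)
      moreover have "(\<lambda>N. T (Suc N) x - x * T N (x - 1)) \<longlonglongrightarrow> l x - x * l (x - 1)"
        by (rule tendsto_diff[OF LIMSEQ_Suc[OF lim[OF x]]
              tendsto_mult[OF tendsto_const lim[OF diff_one_in_Zp[OF x]]]])
      ultimately show ?thesis
        by (simp add: LIMSEQ_const_iff)
    qed
    have "S_op \<phi> = \<psi>"
    proof (rule extensionalityI)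
      show "S_op \<phi> \<in> extensional Zp" "\<psi> \<in> extensional Zp"
        using \<psi> by (auto simp: S_op_def CZp_def)
      show "S_op \<phi> x = \<psi> x" if "x \<in> Zp" for x
        using eq[OF that] that by (simp add: S_op_eq \<phi>_def)
    qed
    thus "\<psi> \<in> S_op ` CZp" using \<phi> by blast
  qed (auto intro: S_op_in_CZp)
qed

end

theory Submission
  imports Defs
begin

text \<open>
  Everything rests on the identity \<open>I_op (S_op \<psi>) (s - 1) = I_op \<psi> s\<close>. Since
  \<open>S_op \<psi> (- 1 - n) = \<psi> (- 1 - n) + (n + 1) \<psi> (- 1 - (n + 1))\<close> and \<open>(n + 1) n! = (n + 1)!\<close>, applying
  \<^const>\<open>S_op\<close> replaces each coefficient \<open>n! \<psi> (- 1 - n)\<close> of the Mahler series \<open>I_op \<psi>\<close> by its sum with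
  the next one, and Pascal's rule says that this is what a shift of the argument by 1 does
  (\<open>I_op_S_op\<close>). As \<open>I_op \<psi> 0 = \<psi> (- 1)\<close>, iteration gives the value \<open>S_iter m \<psi> (- 1)\<close> at every
  integer \<open>m\<close>. For negative \<open>m\<close> the identity is applied to \<open>\<phi> = S_iter m \<psi>\<close>, from which \<open>\<psi>\<close> is recovered
  by \<open>- m\<close> applications of \<^const>\<open>S_op\<close>. Since \<open>n!\<close> tends to 0, while \<open>\<psi>\<close> is bounded
  and binomial coefficients take values of absolute value at most 1 on the p-adic integers, the series converges
  uniformly and its sum is continuous. The extension is unique as the integers are dense.

  For local analyticity at \<open>x\<close>, write the series as the sum of \<open>\<psi> (- 1 - n) (x + t) (x + t - 1) \<cdots> (x + t - n + 1)\<close>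
  over \<open>n\<close> and expand each falling factorial in powers of \<open>t\<close>. On the disc \<open>absval t \<le> 1 / p\<close> the factor
  \<open>x - i + t\<close> has Gauss norm \<open>max (absval (x - i)) (1 / p)\<close>. This never exceeds 1, and it equals \<open>1 / p\<close> for
  at least one \<open>i\<close> out of any \<open>p\<close> consecutive ones, so the Gauss norm of the \<open>n\<close>-th falling factorial tends to 0
  (\<open>falling_gauss_bound_tendsto_zero\<close>). In an ultrametric field this is enough to
  exchange the two summations (\<open>sums_power_series_of_polys\<close>).
\<close>

section \<open>Series in a complete ultrametric field\<close>

lemma ultrametric_sums_le:
  fixes f :: "nat \<Rightarrow> 'c::complete_ultrametric_field"
  assumes "f sums l" "\<And>n. absval (f n) \<le> e"
  shows "absval l \<le> e"
proof -
  have "0 \<le> e" using assms(2)[of 0] absval_ge_zero[of "f 0"] by linarith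
  hence "absval (\<Sum>n<N. f n) \<le> e" for N
    by (intro absval_sum_le assms(2))
  moreover have "(\<lambda>N. absval (\<Sum>n<N. f n)) \<longlonglongrightarrow> absval l"
    using assms(1) unfolding sums_def absval_eq_dist by (intro tendsto_dist tendsto_const)
  ultimately show ?thesis by (intro LIMSEQ_le_const2) auto
qed

lemma ultrametric_sums_mult_right:
  fixes f :: "nat \<Rightarrow> 'c::complete_ultrametric_field"
  assumes "f sums l"
  shows "(\<lambda>n. f n * c) sums (l * c)"
proof -
  have "(\<lambda>N. (\<Sum>n<N. f n) * c) \<longlonglongrightarrow> l * c"
    using assms unfolding sums_def by (intro tendsto_mult tendsto_const)
  thus ?thesis by (simp add: sums_def sum_distrib_right)
qed

lemma ultrametric_sums_diff:
  fixes f g :: "nat \<Rightarrow> 'c::complete_ultrametric_field"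
  assumes "f sums a" "g sums b"
  shows "(\<lambda>n. f n - g n) sums (a - b)"
  using tendsto_diff[OF assms[unfolded sums_def]] by (simp add: sums_def sum_subtractf)

lemma ultrametric_weierstrass_M_test:
  fixes f :: "nat \<Rightarrow> 'a \<Rightarrow> 'c::complete_ultrametric_field"
  assumes M: "M \<longlonglongrightarrow> 0" and le: "\<And>n x. x \<in> A \<Longrightarrow> absval (f n x) \<le> M n"
  shows "uniform_limit A (\<lambda>N x. \<Sum>n<N. f n x) (\<lambda>x. \<Sum>n. f n x) sequentially"
proof (rule uniform_limitI)
  fix e :: real assume "e > 0"
  hence "\<forall>\<^sub>F n in sequentially. M n < e / 2"
    using order_tendstoD(2)[OF M, of "e / 2"] by simp
  then obtain N where N: "\<And>n. n \<ge> N \<Longrightarrow> M n < e / 2"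
    unfolding eventually_sequentially by blast
  have "dist (\<Sum>n<m. f n x) (\<Sum>n. f n x) < e" if m: "m \<ge> N" and x: "x \<in> A" for m x
  proof -
    have "(\<lambda>n. absval (f n x)) \<longlonglongrightarrow> 0"
      by (rule tendsto_sandwich[OF _ _ tendsto_const M]) (auto simp: le[OF x])
    hence "(\<lambda>n. f n x) sums (\<Sum>n. f n x)"
      by (intro summable_sums cuf_summable)
    moreover have "(\<lambda>n. if n \<in> {..<m} then f n x else 0) sums (\<Sum>n<m. f n x)"
      by (rule sums_If_finite_set) simp
    ultimately have "(\<lambda>n. (if n \<in> {..<m} then f n x else 0) - f n x) sums
        ((\<Sum>n<m. f n x) - (\<Sum>n. f n x))"
      by (intro ultrametric_sums_diff)
    moreover have "absval ((if n \<in> {..<m} then f n x else 0) - f n x) \<le> e / 2" for n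
      using le[OF x, of n] N[of n] m \<open>e > 0\<close> by auto
    ultimately have "absval ((\<Sum>n<m. f n x) - (\<Sum>n. f n x)) \<le> e / 2"
      by (rule ultrametric_sums_le)
    thus ?thesis using \<open>e > 0\<close> by (simp add: dist_absval)
  qed
  thus "\<forall>\<^sub>F m in sequentially. \<forall>x\<in>A. dist (\<Sum>n<m. f n x) (\<Sum>n. f n x) < e"
    unfolding eventually_sequentially by blast
qed


section \<open>Gauss norms and rearrangement into a power series\<close>

text \<open>
  Submultiplicativity of the Gauss norm, the maximum over \<open>k\<close> of \<open>absval (coeff P k) * r ^ k\<close>: each
  product contributing to the coefficient of degree \<open>k\<close> splits \<open>r ^ k\<close> as \<open>r ^ i * r ^ (k - i)\<close>, and the
  ultrametric inequality passes from the products to their sum without loss.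
\<close>

lemma gauss_bound_mult:
  fixes P Q :: "'c::complete_ultrametric_field poly"
  assumes "r > 0"
    and P: "\<And>k. absval (coeff P k) * r ^ k \<le> M" and Q: "\<And>k. absval (coeff Q k) * r ^ k \<le> N"
  shows "absval (coeff (P * Q) k) * r ^ k \<le> M * N"
proof -
  have rk: "r ^ k > 0" using assms(1) by simp
  have "0 \<le> M" "0 \<le> N"
    using order_trans[OF absval_ge_zero, of "coeff P 0" M] order_trans[OF absval_ge_zero, of "coeff Q 0" N]
      P[of 0] Q[of 0] by simp_all
  have "absval (coeff (P * Q) k) \<le> M * N / r ^ k"
    unfolding coeff_mult
  proof (rule absval_sum_le)
    fix i assume i: "i \<in> {..k}"
    have "absval (coeff P i * coeff Q (k - i)) * r ^ k
        = (absval (coeff P i) * r ^ i) * (absval (coeff Q (k - i)) * r ^ (k - i))"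
      using i by (simp add: absval_mult flip: power_add)
    also have "\<dots> \<le> M * N"
      using assms(1) \<open>0 \<le> M\<close> by (intro mult_mono P Q) auto
    finally show "absval (coeff P i * coeff Q (k - i)) \<le> M * N / r ^ k"
      using rk by (simp add: field_simps)
  qed (use \<open>0 \<le> M\<close> \<open>0 \<le> N\<close> rk in simp)
  thus ?thesis using rk by (simp add: field_simps)
qed

text \<open>
  Exchange of the sum over \<open>n\<close> with the expansion in powers of \<open>t\<close>. Cutting every polynomial off at degree
  \<open>K\<close> does not change those with \<open>n < K\<close>, by the bound on the degree, and changes the others by at most
  \<open>G n\<close>. By the ultrametric inequality the total error is at most the largest \<open>G n\<close> with \<open>n \<ge> K\<close>, so it
  tends to 0.
\<close>

lemma sums_power_series_of_polys:
  fixes P :: "nat \<Rightarrow> 'c::complete_ultrametric_field poly"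
  assumes G: "G \<longlonglongrightarrow> 0" and le: "\<And>n k. absval (coeff (P n) k) * r ^ k \<le> G n"
    and deg: "\<And>n. degree (P n) \<le> n" and r: "r > 0" and t: "absval t \<le> r"
  shows "(\<lambda>k. (\<Sum>n. coeff (P n) k) * t ^ k) sums (\<Sum>n. poly (P n) t)"
proof -
  have G_nonneg: "0 \<le> G n" for n
    using order_trans[OF absval_ge_zero, of "coeff (P n) 0" "G n"] le[of n 0] by simp
  have term_le: "absval (coeff (P n) k * t ^ k) \<le> G n" for n k
  proof -
    have "absval (coeff (P n) k * t ^ k) \<le> absval (coeff (P n) k) * r ^ k"
      unfolding absval_mult absval_power using t by (intro mult_left_mono power_mono) auto
    thus ?thesis using le[of n k] by linarith
  qed
  have partial_le: "absval (\<Sum>k<K. coeff (P n) k * t ^ k) \<le> G n" for n K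
    by (intro absval_sum_le term_le G_nonneg)
  have poly_eq: "poly (P n) t = (\<Sum>k<K. coeff (P n) k * t ^ k)" if "n < K" for n K
    unfolding poly_altdef using deg[of n] that
    by (intro sum.mono_neutral_left) (auto simp: coeff_eq_0)
  have poly_le: "absval (poly (P n) t) \<le> G n" for n
    unfolding poly_eq[OF lessI] by (rule partial_le)
  have col: "(\<lambda>n. coeff (P n) k) sums (\<Sum>n. coeff (P n) k)" for k
  proof (intro summable_sums cuf_summable)
    have "absval (coeff (P n) k) \<le> G n / r ^ k" for n
      using le[of n k] r by (simp add: field_simps)
    hence upper: "\<forall>\<^sub>F n in sequentially. absval (coeff (P n) k) \<le> G n / r ^ k" by simp
    have lim: "(\<lambda>n. G n / r ^ k) \<longlonglongrightarrow> 0"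
      using tendsto_divide[OF G tendsto_const[of "r ^ k"]] r by simp
    show "(\<lambda>n. absval (coeff (P n) k)) \<longlonglongrightarrow> 0"
      by (rule tendsto_sandwich[OF _ upper tendsto_const lim]) simp
  qed
  have "(\<lambda>n. absval (poly (P n) t)) \<longlonglongrightarrow> 0"
    by (rule tendsto_sandwich[OF _ _ tendsto_const G]) (auto simp: poly_le)
  hence row: "(\<lambda>n. poly (P n) t) sums (\<Sum>n. poly (P n) t)"
    by (intro summable_sums cuf_summable)
  show ?thesis
    unfolding sums_def
  proof (rule metric_LIMSEQ_I)
    fix e :: real assume "e > 0"
    hence "\<forall>\<^sub>F n in sequentially. G n < e / 2"
      using order_tendstoD(2)[OF G, of "e / 2"] by simp
    then obtain N where N: "\<And>n. n \<ge> N \<Longrightarrow> G n < e / 2"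
      unfolding eventually_sequentially by blast
    have "dist (\<Sum>k<K. (\<Sum>n. coeff (P n) k) * t ^ k) (\<Sum>n. poly (P n) t) < e" if "K \<ge> N" for K
    proof -
      have "(\<lambda>n. (\<Sum>k<K. coeff (P n) k * t ^ k) - poly (P n) t) sums
          ((\<Sum>k<K. (\<Sum>n. coeff (P n) k) * t ^ k) - (\<Sum>n. poly (P n) t))"
        by (intro ultrametric_sums_diff sums_sum ultrametric_sums_mult_right col row)
      moreover have "absval ((\<Sum>k<K. coeff (P n) k * t ^ k) - poly (P n) t) \<le> e / 2" for n
      proof (cases "n < K")
        case False
        have "absval ((\<Sum>k<K. coeff (P n) k * t ^ k) - poly (P n) t) \<le> G n"
          using absval_diff_le_max max.boundedI[OF partial_le poly_le] by (rule order_trans)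
        thus ?thesis using N[of n] False that by simp
      qed (use \<open>e > 0\<close> in \<open>simp add: poly_eq\<close>)
      ultimately have "absval ((\<Sum>k<K. (\<Sum>n. coeff (P n) k) * t ^ k) - (\<Sum>n. poly (P n) t)) \<le> e / 2"
        by (rule ultrametric_sums_le)
      thus ?thesis using \<open>e > 0\<close> by (simp add: dist_absval)
    qed
    thus "\<exists>N. \<forall>K\<ge>N. dist (\<Sum>k<K. (\<Sum>n. coeff (P n) k) * t ^ k) (\<Sum>n. poly (P n) t) < e"
      by blast
  qed
qed


section \<open>Falling factorials around a p-adic integer\<close>

definition falling_poly :: "'c::complete_ultrametric_field \<Rightarrow> nat \<Rightarrow> 'c poly"
  where "falling_poly x n = (\<Prod>i<n. [:x - of_nat i, 1:])"

lemma degree_falling_poly: "degree (falling_poly x n) \<le> n"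
proof -
  have "degree (falling_poly x n) \<le> (\<Sum>i<n. degree [:x - of_nat i, 1:])"
    unfolding falling_poly_def
    using degree_prod_sum_le[of "{..<n}" "\<lambda>i. [:x - of_nat i, 1:]"] by (simp add: o_def)
  thus ?thesis by simp
qed

lemma poly_falling_poly: "poly (falling_poly x n) t = fact n * ((x + t) gchoose n)"
  by (simp add: falling_poly_def poly_prod gbinomial_mult_fact lessThan_atLeast0 algebra_simps)

text \<open>
  The product of the Gauss norms, at radius \<open>r\<close>, of the linear factors of \<^const>\<open>falling_poly\<close>.
\<close>

definition falling_gauss_bound :: "real \<Rightarrow> 'c::complete_ultrametric_field \<Rightarrow> nat \<Rightarrow> real"
  where "falling_gauss_bound r x n = (\<Prod>i<n. max (absval (x - of_nat i)) r)"

lemma absval_coeff_falling_poly_le: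
  assumes "r > 0"
  shows "absval (coeff (falling_poly x n) k) * r ^ k \<le> falling_gauss_bound r x n"
proof (induction n arbitrary: k)
  case 0
  show ?case by (cases k) (simp_all add: falling_poly_def falling_gauss_bound_def)
next
  case (Suc n)
  have "absval (coeff [:x - of_nat n, 1:] k) * r ^ k \<le> max (absval (x - of_nat n)) r" for k
    using assms by (cases k; cases "k - 1") (auto simp: coeff_pCons split: nat.splits)
  from gauss_bound_mult[OF assms Suc this] show ?case
    by (simp add: falling_poly_def falling_gauss_bound_def mult.commute)
qed

text \<open>
  Among any \<open>p\<close> consecutive natural numbers \<open>i\<close>, one is congruent modulo \<open>p\<close> to an integer at distance
  at most \<open>1 / p\<close> from \<open>x\<close>. Its factor is \<open>1 / p\<close>, while no factor exceeds 1. So \<open>p\<close> further factors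
  shrink the product at least by \<open>1 / p\<close>.
\<close>

lemma falling_gauss_bound_tendsto_zero:
  fixes x :: "'c::complete_ultrametric_field"
  assumes "prime p" "is_Cp p TYPE('c)" "x \<in> Zp"
  shows "falling_gauss_bound (1 / real p) x \<longlonglongrightarrow> 0"
proof -
  define q where "q = (\<lambda>i. max (absval (x - of_nat i)) (1 / real p))"
  define G where "G = falling_gauss_bound (1 / real p) x"
  have G_eq: "G n = (\<Prod>i<n. q i)" for n
    by (simp add: G_def falling_gauss_bound_def q_def)
  have p: "p > 1" using prime_gt_1_nat[OF assms(1)] .
  have q0: "0 \<le> q i" for i by (simp add: q_def le_max_iff_disj)
  have q1: "q i \<le> 1" for i
    using absval_gchoose_le_one[of "x - of_nat i" 1] assms(3) p by (simp add: q_def)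
  have G0: "0 \<le> G n" for n unfolding G_eq by (intro prod_nonneg) (simp add: q0)
  have G_Suc: "G (Suc n) \<le> G n" for n
    using mult_left_mono[OF q1[of n] G0[of n]] by (simp add: G_eq)
  hence anti: "G n \<le> G m" if "m \<le> n" for m n
    using that by (rule lift_Suc_antimono_le)
  obtain m where m: "absval (x - of_int m) \<le> 1 / real p"
  proof -
    have "0 < 1 / real p" using p by simp
    then obtain y where "y \<in> \<int>" "dist y x < 1 / real p"
      using assms(3) unfolding Zp_def closure_approachable by blast
    thus ?thesis
      using that by (metis Ints_cases dist_commute dist_absval less_imp_le)
  qed
  have block: "G (n + p) \<le> G n * (1 / real p)" for n
  proof -
    \<comment> \<open>The element of the block \<open>{n..<n + p}\<close> that is congruent to \<open>m\<close> modulo \<open>p\<close>.\<close>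
    define i where "i = n + nat ((m - int n) mod int p)"
    have i: "i \<in> {n..<n + p}"
      using p pos_mod_bound[of "int p" "m - int n"] by (simp add: i_def nat_less_iff)
    have "int i = int n + (m - int n) mod int p" using p by (simp add: i_def)
    hence "int p dvd m - int i"
      by (metis diff_diff_eq dvd_minus_mod)
    then obtain j where j: "m - int i = int p * j" unfolding dvd_def by blast
    have "x - of_nat i = (x - of_int m) + of_int (m - int i)" by simp
    also have "absval \<dots> \<le> max (absval (x - of_int m)) (absval (of_int (m - int i) :: 'c))"
      by (rule absval_add_le_max)
    also have "absval (of_int (m - int i) :: 'c) \<le> 1 / real p"
      using absval_of_int_le_one[of j, where ?'c = 'c] p
      by (simp add: j absval_mult is_Cp_absval_p[OF assms(2)] field_simps)
    finally have qi: "q i = 1 / real p" using m by (simp add: q_def)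
    have "(\<Prod>k=n..<n+p. q k) = q i * (\<Prod>k\<in>{n..<n+p} - {i}. q k)"
      by (rule prod.remove) (use i in auto)
    also have "\<dots> \<le> q i * 1"
      by (intro mult_left_mono prod_le_1) (auto simp: q0 q1)
    finally have "(\<Prod>k=n..<n+p. q k) \<le> 1 / real p" by (simp add: qi)
    moreover have "G (n + p) = G n * (\<Prod>k=n..<n+p. q k)"
      unfolding G_eq lessThan_atLeast0 by (rule prod.atLeastLessThan_concat[symmetric]) auto
    ultimately show ?thesis using mult_left_mono G0 by metis
  qed
  have G_power: "G (p * j) \<le> (1 / real p) ^ j" for j
  proof (induction j)
    case (Suc j)
    have "G (p * Suc j) \<le> G (p * j) * (1 / real p)"
      using block[of "p * j"] by (simp add: add.commute)
    also have "\<dots> \<le> (1 / real p) ^ j * (1 / real p)"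
      using Suc by (intro mult_right_mono) auto
    finally show ?case by (simp add: mult.commute)
  qed (simp add: G_eq)
  have "G \<longlonglongrightarrow> 0"
  proof (rule LIMSEQ_I)
    fix e :: real assume "e > 0"
    then obtain j where j: "(1 / real p) ^ j < e"
      using real_arch_pow_inv[of e "1 / real p"] p by auto
    have "norm (G n - 0) < e" if "n \<ge> p * j" for n
      using anti[OF that] G_power[of j] j G0[of n] by simp
    thus "\<exists>N. \<forall>n\<ge>N. norm (G n - 0) < e" by blast
  qed
  thus ?thesis by (simp add: G_def)
qed


section \<open>The transform of a continuous function\<close>

lemma minus_one_minus_of_nat_in_Zp [simp]: "- 1 - of_nat n \<in> Zp"
  using of_int_in_Zp[of "- 1 - int n"] by simp

lemma I_op_in_CZp:
  assumes "prime p" "is_Cp p TYPE('c::complete_ultrametric_field)"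
    and "\<psi> \<in> (CZp :: ('c \<Rightarrow> 'c) set)"
  shows "I_op \<psi> \<in> CZp"
proof -
  obtain B where B: "\<And>x. x \<in> Zp \<Longrightarrow> absval (\<psi> x) \<le> B"
    using CZp_bounded[OF assms] by metis
  let ?f = "\<lambda>n s. fact n * \<psi> (- 1 - of_nat n) * (s gchoose n)"
  have "uniform_limit Zp (\<lambda>N s. \<Sum>n<N. ?f n s) (\<lambda>s. \<Sum>n. ?f n s) sequentially"
  proof (rule ultrametric_weierstrass_M_test)
    show "(\<lambda>n. absval (fact n :: 'c) * B) \<longlonglongrightarrow> 0"
      using tendsto_mult_right[OF absval_fact_tendsto_zero[OF assms(1,2)], of B] by simp
    show "absval (?f n s) \<le> absval (fact n :: 'c) * B" if "s \<in> Zp" for n s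
      using absval_I_op_term_le[of \<psi> B, OF B] that by simp
  qed
  moreover have "continuous_on Zp (\<lambda>s. \<Sum>n<N. ?f n s)" for N
  proof -
    have "continuous_on Zp (\<lambda>s::'c. inverse (fact n) * (\<Prod>i = 0..<n. s - of_nat i))" for n
      by (intro continuous_on_mult' continuous_on_prod' continuous_intros)
    hence "continuous_on Zp (\<lambda>s::'c. s gchoose n)" for n
      by (simp add: gbinomial_prod_rev field_simps)
    thus ?thesis
      by (intro continuous_on_sum continuous_on_mult' continuous_on_const)
  qed
  ultimately have "continuous_on Zp (\<lambda>s. \<Sum>n. ?f n s)"
    by (intro uniform_limit_theorem) auto
  thus ?thesis by (simp add: CZp_def I_op_def cong: continuous_on_cong)
qed

text \<open>
  With \<open>f n = n! \<psi> (- 1 - n)\<close>, the coefficients of the transform of \<open>S_op \<psi>\<close> are \<open>f n + f (n + 1)\<close>. By Pascal's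
  rule the partial sums of the two series agree up to the single term \<open>f N * ((s - 1) gchoose N)\<close>, which
  tends to 0 as the general term of a convergent series.
\<close>

lemma I_op_S_op:
  assumes "prime p" "is_Cp p TYPE('c::complete_ultrametric_field)"
    and "\<psi> \<in> (CZp :: ('c \<Rightarrow> 'c) set)" "s \<in> Zp"
  shows "I_op (S_op \<psi>) (s - 1) = I_op \<psi> s"
proof -
  define f where "f = (\<lambda>n. fact n * \<psi> (- 1 - of_nat n))"
  define g where "g = (\<lambda>n. fact n * S_op \<psi> (- 1 - of_nat n))"
  have g_eq: "g n = f n + f (Suc n)" for n
  proof -
    have "S_op \<psi> (- 1 - of_nat n) = \<psi> (- 1 - of_nat n) + of_nat (Suc n) * \<psi> (- 1 - of_nat (Suc n))"
      by (subst S_op_eq) (simp_all add: algebra_simps)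
    thus ?thesis by (simp add: f_def g_def algebra_simps)
  qed
  have s1: "s - 1 \<in> Zp" using assms(4) by simp
  have lim_g: "(\<lambda>N. \<Sum>n<N. g n * ((s - 1) gchoose n)) \<longlonglongrightarrow> I_op (S_op \<psi>) (s - 1)"
    using summable_LIMSEQ[OF summable_I_op[OF assms(1,2) S_op_in_CZp[OF assms(3)] s1]] s1
    by (simp add: I_op_def g_def)
  have lim_f: "(\<lambda>N. \<Sum>n<N. f n * (s gchoose n)) \<longlonglongrightarrow> I_op \<psi> s"
    using summable_LIMSEQ[OF summable_I_op[OF assms]] assms(4) by (simp add: I_op_def f_def)
  have lim_f1: "(\<lambda>N. \<Sum>n<N. f n * ((s - 1) gchoose n)) \<longlonglongrightarrow> I_op \<psi> (s - 1)"
    using summable_LIMSEQ[OF summable_I_op[OF assms(1-3) s1]] s1 by (simp add: I_op_def f_def)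
  \<comment> \<open>The general term is the difference of consecutive partial sums.\<close>
  have "(\<lambda>N. (\<Sum>n<Suc N. f n * ((s - 1) gchoose n)) - (\<Sum>n<N. f n * ((s - 1) gchoose n)))
      \<longlonglongrightarrow> I_op \<psi> (s - 1) - I_op \<psi> (s - 1)"
    by (rule tendsto_diff[OF LIMSEQ_Suc[OF lim_f1] lim_f1])
  hence "(\<lambda>N. f N * ((s - 1) gchoose N)) \<longlonglongrightarrow> 0" by simp
  hence "(\<lambda>N. (\<Sum>n<N. g n * ((s - 1) gchoose n)) + f N * ((s - 1) gchoose N))
      \<longlonglongrightarrow> I_op (S_op \<psi>) (s - 1) + 0"
    by (intro tendsto_add lim_g)
  moreover have "(\<Sum>n<N. g n * ((s - 1) gchoose n)) + f N * ((s - 1) gchoose N)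
      = (\<Sum>n<Suc N. f n * (s gchoose n))" for N
  proof (induction N)
    case (Suc N)
    have "s gchoose Suc N = ((s - 1) gchoose N) + ((s - 1) gchoose Suc N)"
      using gbinomial_Suc_Suc[of "s - 1" N] by simp
    thus ?case using Suc by (simp add: g_eq algebra_simps)
  qed simp
  ultimately have "(\<lambda>N. \<Sum>n<Suc N. f n * (s gchoose n)) \<longlonglongrightarrow> I_op (S_op \<psi>) (s - 1)"
    by simp
  with LIMSEQ_Suc[OF lim_f] show ?thesis by (rule LIMSEQ_unique[symmetric])
qed

lemma I_op_zero:
  fixes \<psi> :: "'c::complete_ultrametric_field \<Rightarrow> 'c"
  shows "I_op \<psi> 0 = \<psi> (- 1)"
proof -
  have "(\<Sum>n. fact n * \<psi> (- 1 - of_nat n) * (0 gchoose n))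
      = (\<Sum>n\<in>{0}. fact n * \<psi> (- 1 - of_nat n) * (0 gchoose n))"
    by (rule suminf_finite) (auto simp: gbinomial_0_left)
  moreover have "(0 :: 'c) \<in> Zp" using of_nat_in_Zp[of 0] by simp
  ultimately show ?thesis by (simp add: I_op_def)
qed

lemma S_op_funpow_in_CZp: "\<psi> \<in> CZp \<Longrightarrow> (S_op ^^ k) \<psi> \<in> CZp"
  by (induction k) (auto intro: S_op_in_CZp)

lemma I_op_S_op_funpow:
  assumes "prime p" "is_Cp p TYPE('c::complete_ultrametric_field)"
    and "\<psi> \<in> (CZp :: ('c \<Rightarrow> 'c) set)"
  shows "I_op ((S_op ^^ k) \<psi>) (of_int m) = I_op \<psi> (of_int (m + int k))"
proof (induction k arbitrary: m)
  case (Suc k)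
  have "I_op ((S_op ^^ Suc k) \<psi>) (of_int m) = I_op (S_op ((S_op ^^ k) \<psi>)) (of_int (m + 1) - 1)"
    by simp
  also have "\<dots> = I_op ((S_op ^^ k) \<psi>) (of_int (m + 1))"
    by (rule I_op_S_op[OF assms(1,2) S_op_funpow_in_CZp[OF assms(3)]]) (rule of_int_in_Zp)
  also have "\<dots> = I_op \<psi> (of_int (m + 1 + int k))" by (rule Suc)
  finally show ?case by (simp add: algebra_simps)
qed simp

lemma inv_S_op_funpow:
  assumes "prime p" "is_Cp p TYPE('c::complete_ultrametric_field)"
    and "\<psi> \<in> (CZp :: ('c \<Rightarrow> 'c) set)"
  shows "(inv_into CZp S_op ^^ k) \<psi> \<in> CZp \<and> (S_op ^^ k) ((inv_into CZp S_op ^^ k) \<psi>) = \<psi>"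
proof (induction k)
  case (Suc k)
  define \<phi> where "\<phi> = (inv_into CZp S_op ^^ k) \<psi>"
  have "\<phi> \<in> S_op ` CZp"
    using Suc bij_betw_S_op[OF assms(1,2)] by (simp add: bij_betw_def \<phi>_def)
  hence "inv_into CZp S_op \<phi> \<in> CZp" "S_op (inv_into CZp S_op \<phi>) = \<phi>"
    by (auto intro: inv_into_into simp: f_inv_into_f)
  moreover have "(S_op ^^ Suc k) (inv_into CZp S_op \<phi>) = (S_op ^^ k) (S_op (inv_into CZp S_op \<phi>))"
    by (simp only: funpow_Suc_right o_apply)
  ultimately show ?case
    using Suc unfolding \<phi>_def by (metis funpow.simps(2) o_apply)
qed (simp add: assms(3))

text \<open>
  For negative \<open>m\<close> the shift rule is used backwards, starting from the preimage \<open>\<phi>\<close> of \<open>\<psi>\<close> under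
  \<open>- m\<close> applications of \<^const>\<open>S_op\<close>.
\<close>

lemma I_op_of_int:
  assumes "prime p" "is_Cp p TYPE('c::complete_ultrametric_field)"
    and "\<psi> \<in> (CZp :: ('c \<Rightarrow> 'c) set)"
  shows "I_op \<psi> (of_int m) = S_iter m \<psi> (- 1)"
proof (cases "m \<ge> 0")
  case True
  thus ?thesis
    using I_op_S_op_funpow[OF assms, of "nat m" 0] by (simp add: S_iter_def I_op_zero)
next
  case False
  define \<phi> where "\<phi> = (inv_into CZp S_op ^^ nat (- m)) \<psi>"
  have \<phi>: "\<phi> \<in> CZp" "(S_op ^^ nat (- m)) \<phi> = \<psi>"
    using inv_S_op_funpow[OF assms] by (simp_all add: \<phi>_def)
  have "I_op \<psi> (of_int m) = I_op \<phi> (of_int (m + int (nat (- m))))"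
    using I_op_S_op_funpow[OF assms(1,2) \<phi>(1), of "nat (- m)" m] by (simp only: \<phi>(2))
  thus ?thesis using False by (simp add: I_op_zero S_iter_def \<phi>_def)
qed

text \<open>
  On the ball of radius \<open>1 / p\<close> around \<open>x0\<close>, the transform is a sum of multiples of falling
  factorials. Their coefficients \<open>\<psi> (- 1 - n)\<close> are bounded by some \<open>B\<close>, so the Gauss norms of the multiples still
  tend to 0, and the sum can be rearranged into a power series.
\<close>

lemma locally_analytic_I_op:
  assumes "prime p" "is_Cp p TYPE('c::complete_ultrametric_field)"
    and "\<psi> \<in> (CZp :: ('c \<Rightarrow> 'c) set)"
  shows "locally_analytic_on_Zp (I_op \<psi>)"
  unfolding locally_analytic_on_Zp_def
proof
  fix x0 :: 'c assume x0: "x0 \<in> Zp"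
  obtain B where B: "B > 0" "\<And>x. x \<in> Zp \<Longrightarrow> absval (\<psi> x) \<le> B"
    using CZp_bounded[OF assms] by metis
  have p: "1 / real p > 0" using prime_gt_0_nat[OF assms(1)] by simp
  define P where "P = (\<lambda>n. smult (\<psi> (- 1 - of_nat n)) (falling_poly x0 n))"
  let ?G = "falling_gauss_bound (1 / real p) x0"
  have G: "(\<lambda>n. B * ?G n) \<longlonglongrightarrow> 0"
    using tendsto_mult_left[OF falling_gauss_bound_tendsto_zero[OF assms(1,2) x0], of B] by simp
  have le: "absval (coeff (P n) k) * (1 / real p) ^ k \<le> B * ?G n" for n k
  proof -
    have "absval (coeff (P n) k) * (1 / real p) ^ k
        = absval (\<psi> (- 1 - of_nat n)) * (absval (coeff (falling_poly x0 n) k) * (1 / real p) ^ k)"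
      by (simp add: P_def absval_mult)
    also have "\<dots> \<le> B * ?G n"
      using B p by (intro mult_mono absval_coeff_falling_poly_le) auto
    finally show ?thesis .
  qed
  have deg: "degree (P n) \<le> n" for n
    unfolding P_def using degree_smult_le degree_falling_poly order_trans by blast
  have "(\<lambda>k. (\<Sum>n. coeff (P n) k) * (x - x0) ^ k) sums I_op \<psi> x"
    if x: "x \<in> ball x0 (1 / real p) \<inter> Zp" for x
  proof -
    have "absval (x - x0) \<le> 1 / real p"
      using x by (simp add: dist_commute flip: dist_absval)
    moreover have "(\<Sum>n. poly (P n) (x - x0)) = I_op \<psi> x"
      using x by (simp add: P_def I_op_def poly_falling_poly mult_ac)
    ultimately show ?thesis
      using sums_power_series_of_polys[OF G le deg p] by metis
  qed
  thus "\<exists>U a. open U \<and> x0 \<in> U \<and> (\<forall>x\<in>U \<inter> Zp. (\<lambda>n. a n * (x - x0) ^ n) sums I_op \<psi> x)"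
    using p by (intro exI[of _ "ball x0 (1 / real p)"] exI[of _ "\<lambda>k. \<Sum>n. coeff (P n) k"]) auto
qed

theorem theorem6p5:
  fixes p :: nat and \<psi> :: "'c::complete_ultrametric_field \<Rightarrow> 'c"
  assumes "prime p"
    and "is_Cp p TYPE('c)"
    and "\<psi> \<in> CZp"
  shows "(\<exists>!f. f \<in> CZp \<and> (\<forall>m::int. f (of_int m) = S_iter m \<psi> (- 1))) \<and>
    (I_op \<psi> \<in> CZp \<and> (\<forall>m::int. I_op \<psi> (of_int m) = S_iter m \<psi> (- 1))) \<and>
    locally_analytic_on_Zp (I_op \<psi>)"
proof -
  have I: "I_op \<psi> \<in> CZp \<and> (\<forall>m::int. I_op \<psi> (of_int m) = S_iter m \<psi> (- 1))"
    using I_op_in_CZp[OF assms] I_op_of_int[OF assms] by blast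
  have "f = I_op \<psi>" if f: "f \<in> CZp \<and> (\<forall>m::int. f (of_int m) = S_iter m \<psi> (- 1))" for f
  proof (rule CZp_eqI[OF assms(1,2)])
    show "f (of_nat n) = I_op \<psi> (of_nat n)" for n
      using f I by (metis of_int_of_nat_eq)
  qed (use f I in auto)
  with I have "\<exists>!f. f \<in> CZp \<and> (\<forall>m::int. f (of_int m) = S_iter m \<psi> (- 1))"
    by blast
  with I locally_analytic_I_op[OF assms] show ?thesis by blast
qed

end
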